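(* Let $\mathbb{G}_\infty$, $F_k$ and $j_k$ be as in the context. For every $\tau\in\mathbb{G}_\infty\setminus\{0\}$ the Limit-Fourier coefficient $$j(\tau):=-\lim_{k\to\infty}2^{-k}\sum_{\sigma\in\mathbb{G}_k}F_k(\sigma)(-1)^{\sigma\cdot p_k(\tau)}$$ satisfies $j(\tau)\ge 0$.
   Context: For $k\in\mathbb{N}_0$ let $\mathbb{G}_k=(\mathbb{Z}/2\mathbb{Z})^k$ ($\mathbb{G}_0$ a one-point set), with elements $\sigma=(\sigma_1,\dots,\sigma_k)$, $\sigma_i\in\{0,1\}$, and $\sigma\cdot\tau:=\sum_{i=1}^k\sigma_i\tau_i$. Define $\hat h_k,\hat r_k:\{0,\dots,2^k\}\to\mathbb{N}_0$ recursively by $\hat h_0(0)=\hat h_0(1)=1$, $\hat r_0(0)=0$, $\hat r_0(1)=1$, and for $s\in\{0,\dots,2^k\}$: $\hat h_{k+1}(2s)=\hat h_k(s)$, $\hat r_{k+1}(2s)=\hat r_k(s)$; for $s\in\{0,\dots,2^k-1\}$: $\hat h_{k+1}(2s+1)=\hat h_k(s)+\hat h_k(s+1)$, $\hat r_{k+1}(2s+1)=\hat r_k(s)+\hat r_k(s+1)$. (Thus $\hat r_k(s)/\hat h_k(s)$, $s=0,\dots,2^k$, is the $k$-th row of the modified Farey sequence obtained from $0/1,1/1$ by repeatedly inserting mediants.) The Farey function $F_k:\mathbb{G}_k\to\mathbb{Q}\cap[0,1)$ is $F_k(\sigma)=\hat r_k(s)/\hat h_k(s)$ where $s=\sum_{i=1}^k\sigma_i2^{k-i}$.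 Let $\mathbb{G}_\infty$ be the direct sum $\bigoplus_{\mathbb{N}}\mathbb{Z}/2\mathbb{Z}$, i.e. sequences $(\tau_i)_{i\ge1}$ in $\{0,1\}$ with only finitely many nonzero entries, and $p_k:\mathbb{G}_\infty\to\mathbb{G}_k$, $\tau\mapsto(\tau_1,\dots,\tau_k)$. The limit defining $j(\tau)$ exists for every $\tau\in\mathbb{G}_\infty$. *)

theory Defs
  imports Complex_Main "HOL-Library.FuncSet" "HOL-Library.Z2" "HOL-Library.Poly_Mapping"
begin

text \<open>
  The field \<^typ>\<open>bit\<close> plays the role of $\mathbb{Z}/2\mathbb{Z}$; the library abbreviation
  \<open>of_bit\<close> is the lift to $\{0,1\}$.  Coordinates of elements of
  $\mathbb{G}_k$ are indexed by $1,\dots,k$.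
\<close>

definition G :: "nat \<Rightarrow> (nat \<Rightarrow> bit) set" where
  "G k = ({1..k} \<rightarrow>\<^sub>E UNIV)"

text \<open>The dot product is a natural number; it is not reduced modulo 2.\<close>

definition dot :: "nat \<Rightarrow> (nat \<Rightarrow> bit) \<Rightarrow> (nat \<Rightarrow> bit) \<Rightarrow> nat" where
  "dot k \<sigma> \<tau> = (\<Sum>i = 1..k. of_bit (\<sigma> i) * of_bit (\<tau> i))"

text \<open>
  Only the arguments \<open>s \<le> 2 ^ k\<close> are meaningful for \<open>hhat k\<close> and \<open>rhat k\<close>;
  the recursion never leaves this range when started inside it.
\<close>

primrec hhat :: "nat \<Rightarrow> nat \<Rightarrow> nat" where
  "hhat 0 s = 1"
| "hhat (Suc k) s =
     (if even s then hhat k (s div 2) else hhat k (s div 2) + hhat k (s div 2 + 1))"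

primrec rhat :: "nat \<Rightarrow> nat \<Rightarrow> nat" where
  "rhat 0 s = (if s = 0 then 0 else 1)"
| "rhat (Suc k) s =
     (if even s then rhat k (s div 2) else rhat k (s div 2) + rhat k (s div 2 + 1))"

definition index :: "nat \<Rightarrow> (nat \<Rightarrow> bit) \<Rightarrow> nat" where
  "index k \<sigma> = (\<Sum>i = 1..k. of_bit (\<sigma> i) * 2 ^ (k - i))"

definition F :: "nat \<Rightarrow> (nat \<Rightarrow> bit) \<Rightarrow> real" where
  "F k \<sigma> = real (rhat k (index k \<sigma>)) / real (hhat k (index k \<sigma>))"

text \<open>
  The direct sum $\bigoplus_{\mathbb{N}} \mathbb{Z}/2\mathbb{Z}$ is the type of finitely supported
  functions on \<^typ>\<open>nat\<close>.  Since \<^typ>\<open>nat\<close> starts at 0, the coordinate $\tau_i$ ($i \ge 1$)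
  is \<open>Poly_Mapping.lookup \<tau> (i - 1)\<close>.
\<close>

type_synonym G_infty = "nat \<Rightarrow>\<^sub>0 bit"

definition proj :: "nat \<Rightarrow> G_infty \<Rightarrow> (nat \<Rightarrow> bit)" where
  "proj k \<tau> = (\<lambda>i\<in>{1..k}. Poly_Mapping.lookup \<tau> (i - 1))"

definition j :: "G_infty \<Rightarrow> real" where
  "j \<tau> = - lim (\<lambda>k. (1 / 2 ^ k) * (\<Sum>\<sigma>\<in>G k. F k \<sigma> * (-1) ^ dot k \<sigma> (proj k \<tau>)))"

end

theory Submission
  imports Defs
begin

text \<open>
  Put $y_k = 1 - 2 F_k$ and let $s = \pm 1$ be the spin of the first coordinate. The two generating
  maps $x \mapsto x/(1+x)$ and $x \mapsto 1/(2-x)$ of the Farey tree combine to the single formula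
  $y_{k+1} = (s + y_k)/(3 - s y_k)$, a power series in $s$ and $y_k$ with nonnegative coefficients.
  Hence all Walsh coefficients of $y_k$ are nonnegative. Since $y_{k+1}$ restricted to last
  coordinate 0 is $y_k$, the normalized coefficient of $y_k$ at $\tau$ exceeds that of $y_{k+1}$
  by the coefficient of $y_{k+1}$ at $\tau$ with coordinate $k+1$ flipped; so the coefficients
  decrease in $k$ and their limit exists.
\<close>

section \<open>Walsh sums on \<open>G k\<close> and their recursion in the last coordinate\<close>

text \<open>Functions on \<open>G k\<close> enter through the integer index, so rows of the Farey
  sequence can be inserted directly. The factor 2^(-k) is left out to keep the recursion in
  \<open>k\<close> free of factors 1/2.\<close>

definition walsh :: "nat \<Rightarrow> (nat \<Rightarrow> real) \<Rightarrow> (nat \<Rightarrow> bit) \<Rightarrow> real" where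
  "walsh k f t = (\<Sum>\<sigma>\<in>G k. f (index k \<sigma>) * (-1) ^ dot k \<sigma> t)"

lemma sum_G_Suc:
  "(\<Sum>\<sigma>\<in>G (Suc k). g \<sigma>) = (\<Sum>\<sigma>\<in>G k. g (\<sigma>(Suc k := 0)) + g (\<sigma>(Suc k := 1)))"
  for g :: "(nat \<Rightarrow> bit) \<Rightarrow> real"
proof -
  have ins: "{1..Suc k} = insert (Suc k) {1..k}"
    by auto
  have inj: "inj_on (\<lambda>(b, \<sigma>). \<sigma>(Suc k := b)) ((UNIV :: bit set) \<times> G k)"
    unfolding G_def by (rule inj_combinator) simp
  have UNIV_bit: "(UNIV :: bit set) = {0, 1}"
    by (auto intro: bit.exhaust)
  have "(\<Sum>\<sigma>\<in>G (Suc k). g \<sigma>) = (\<Sum>(b, \<sigma>)\<in>(UNIV :: bit set) \<times> G k. g (\<sigma>(Suc k := b)))"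
    unfolding G_def ins PiE_insert_eq
    by (subst sum.reindex) (use inj in \<open>auto simp: G_def case_prod_unfold\<close>)
  also have "\<dots> = (\<Sum>b\<in>UNIV. \<Sum>\<sigma>\<in>G k. g (\<sigma>(Suc k := b)))"
    by (simp add: sum.cartesian_product)
  also have "\<dots> = (\<Sum>\<sigma>\<in>G k. g (\<sigma>(Suc k := 0)) + g (\<sigma>(Suc k := 1)))"
    by (simp add: UNIV_bit sum.distrib)
  finally show ?thesis .
qed

lemma index_Suc: "index (Suc k) (\<sigma>(Suc k := b)) = 2 * index k \<sigma> + of_bit b"
proof -
  have "(\<Sum>i = 1..k. of_bit ((\<sigma>(Suc k := b)) i) * 2 ^ (Suc k - i))
      = (\<Sum>i = 1..k. 2 * (of_bit (\<sigma> i) * 2 ^ (k - i)) :: nat)"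
    by (rule sum.cong) (auto simp: Suc_diff_le)
  then show ?thesis
    unfolding index_def sum_distrib_left
    by (simp only: sum.nat_ivl_Suc' le_add2 Suc_eq_plus1) simp
qed

lemma dot_Suc: "dot (Suc k) (\<sigma>(Suc k := b)) t = dot k \<sigma> t + of_bit b * of_bit (t (Suc k))"
proof -
  have "(\<Sum>i = 1..k. of_bit ((\<sigma>(Suc k := b)) i) * of_bit (t i))
      = (\<Sum>i = 1..k. of_bit (\<sigma> i) * of_bit (t i) :: nat)"
    by (rule sum.cong) auto
  then show ?thesis
    by (simp add: dot_def)
qed

lemma walsh_0: "walsh 0 f t = f 0"
  by (simp add: walsh_def G_def index_def dot_def)

text \<open>The last coordinate is the lowest binary digit of the index, so it pairs
  \<open>2 * s\<close> with \<open>2 * s + 1\<close>; its character adds or subtracts the two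
  values.\<close>

lemma walsh_Suc:
  "walsh (Suc k) f t
    = (if t (Suc k) = 0 then walsh k (\<lambda>s. f (2 * s) + f (2 * s + 1)) t
       else walsh k (\<lambda>s. f (2 * s) - f (2 * s + 1)) t)"
  by (cases "t (Suc k)")
    (simp_all add: walsh_def sum_G_Suc index_Suc dot_Suc algebra_simps)

lemma walsh_diff: "walsh k (\<lambda>s. f s - g s) t = walsh k f t - walsh k g t"
  by (simp add: walsh_def algebra_simps sum_subtractf)

lemma walsh_cmult: "walsh k (\<lambda>s. c * f s) t = c * walsh k f t"
  by (simp add: walsh_def sum_distrib_left mult.assoc)

lemma walsh_add: "walsh k (\<lambda>s. f s + g s) t = walsh k f t + walsh k g t"
  by (simp add: walsh_def algebra_simps sum.distrib)

text \<open>Lets \<open>proj k \<tau>\<close>, which changes with \<open>k\<close>, be replaced by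
  one function for all \<open>k\<close>.\<close>

lemma walsh_cong_upto:
  assumes "\<And>i. i \<in> {1..k} \<Longrightarrow> t i = u i"
  shows "walsh k f t = walsh k f u"
proof -
  have "dot k \<sigma> t = dot k \<sigma> u" for \<sigma>
    unfolding dot_def using assms by (intro sum.cong) auto
  then show ?thesis
    by (simp add: walsh_def)
qed

text \<open>Orthogonality of characters: at a coordinate where \<open>t\<close> is nonzero the two
  equal values cancel.\<close>

lemma walsh_const_eq_0:
  assumes "i \<in> {1..k}" "t i \<noteq> 0"
  shows "walsh k (\<lambda>_. c) t = 0"
  using assms
proof (induction k arbitrary: c)
  case (Suc k)
  show ?case
  proof (cases "t (Suc k) = 0")
    case True
    with Suc.prems have "i \<in> {1..k}"
      by (cases "i = Suc k") auto
    with Suc True show ?thesis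
      by (simp add: walsh_Suc)
  next
    case False
    then show ?thesis
      unfolding walsh_Suc by (simp add: walsh_def)
  qed
qed simp

section \<open>The cone of functions with nonnegative Walsh coefficients\<close>

text \<open>
  Nonnegativity of all Walsh coefficients of \<open>f\<close> on $\{0, \dots, 2^k - 1\}$, phrased recursively
  so that products need no convolution formula.
\<close>

primrec walsh_nonneg :: "nat \<Rightarrow> (nat \<Rightarrow> real) \<Rightarrow> bool" where
  "walsh_nonneg 0 f \<longleftrightarrow> f 0 \<ge> 0"
| "walsh_nonneg (Suc k) f \<longleftrightarrow>
     walsh_nonneg k (\<lambda>s. f (2 * s) + f (2 * s + 1)) \<and>
     walsh_nonneg k (\<lambda>s. f (2 * s) - f (2 * s + 1))"

text \<open>The digits of \<open>t\<close> select one branch in the binary tree of sums and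
  differences, and the leaf reached is the coefficient.\<close>

lemma walsh_nonnegD: "walsh_nonneg k f \<Longrightarrow> walsh k f t \<ge> 0"
  by (induction k arbitrary: f) (auto simp: walsh_0 walsh_Suc)

lemma walsh_nonneg_cong:
  assumes "\<And>s. s < 2 ^ k \<Longrightarrow> f s = g s" "walsh_nonneg k g"
  shows "walsh_nonneg k f"
  using assms
proof (induction k arbitrary: f g)
  case (Suc k)
  have "f (2 * s) = g (2 * s)" "f (2 * s + 1) = g (2 * s + 1)" if "s < 2 ^ k" for s
    using that by (auto intro!: Suc.prems(1))
  with Suc.prems(2) show ?case
    by (auto intro: Suc.IH)
qed simp

lemma walsh_nonneg_add:
  "walsh_nonneg k f \<Longrightarrow> walsh_nonneg k g \<Longrightarrow> walsh_nonneg k (\<lambda>s. f s + g s)"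
proof (induction k arbitrary: f g)
  case (Suc k)
  have "walsh_nonneg k (\<lambda>s. (f (2 * s) + f (2 * s + 1)) + (g (2 * s) + g (2 * s + 1)))"
    "walsh_nonneg k (\<lambda>s. (f (2 * s) - f (2 * s + 1)) + (g (2 * s) - g (2 * s + 1)))"
    using Suc.prems by (auto intro!: Suc.IH)
  then show ?case
    by (simp add: algebra_simps)
qed simp

lemma walsh_nonneg_cmult:
  "c \<ge> 0 \<Longrightarrow> walsh_nonneg k f \<Longrightarrow> walsh_nonneg k (\<lambda>s. c * f s)"
proof (induction k arbitrary: f)
  case (Suc k)
  have "walsh_nonneg k (\<lambda>s. c * (f (2 * s) + f (2 * s + 1)))"
    "walsh_nonneg k (\<lambda>s. c * (f (2 * s) - f (2 * s + 1)))"
    using Suc.prems by (auto intro!: Suc.IH)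
  then show ?case
    by (simp add: algebra_simps)
qed simp

lemma walsh_nonneg_const: "c \<ge> 0 \<Longrightarrow> walsh_nonneg k (\<lambda>_. c)"
  by (induction k arbitrary: c) auto

lemma walsh_nonneg_mult:
  "walsh_nonneg k f \<Longrightarrow> walsh_nonneg k g \<Longrightarrow> walsh_nonneg k (\<lambda>s. f s * g s)"
proof (induction k arbitrary: f g)
  case (Suc k)
  define fp fm gp gm where
    defs: "fp = (\<lambda>s. f (2 * s) + f (2 * s + 1))" "fm = (\<lambda>s. f (2 * s) - f (2 * s + 1))"
    "gp = (\<lambda>s. g (2 * s) + g (2 * s + 1))" "gm = (\<lambda>s. g (2 * s) - g (2 * s + 1))"
  have "walsh_nonneg k fp" "walsh_nonneg k fm" "walsh_nonneg k gp" "walsh_nonneg k gm"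
    using Suc.prems by (simp_all add: defs)
  \<comment> \<open>Multiplication in the group ring of Z/2: the sum and the difference of the
    products are polynomials in \<open>fp\<close>, \<open>fm\<close>, \<open>gp\<close>,
    \<open>gm\<close> with coefficients 1/2.\<close>
  then have "walsh_nonneg k (\<lambda>s. (1 / 2) * (fp s * gp s + fm s * gm s))"
    "walsh_nonneg k (\<lambda>s. (1 / 2) * (fp s * gm s + fm s * gp s))"
    by (intro walsh_nonneg_cmult walsh_nonneg_add Suc.IH; simp)+
  moreover have "(\<lambda>s. (1 / 2) * (fp s * gp s + fm s * gm s))
      = (\<lambda>s. f (2 * s) * g (2 * s) + f (2 * s + 1) * g (2 * s + 1))"
    "(\<lambda>s. (1 / 2) * (fp s * gm s + fm s * gp s))
      = (\<lambda>s. f (2 * s) * g (2 * s) - f (2 * s + 1) * g (2 * s + 1))"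
    by (auto simp: defs field_simps)
  ultimately show ?case
    by simp
qed simp

lemma walsh_nonneg_power: "walsh_nonneg k f \<Longrightarrow> walsh_nonneg k (\<lambda>s. f s ^ n)"
  by (induction n) (auto intro: walsh_nonneg_const walsh_nonneg_mult)

lemma walsh_nonneg_sum:
  "(\<And>i. i < n \<Longrightarrow> walsh_nonneg k (f i)) \<Longrightarrow> walsh_nonneg k (\<lambda>s. \<Sum>i<n. f i s)" for n :: nat
  by (induction n) (auto intro: walsh_nonneg_const walsh_nonneg_add)

text \<open>The conditions are weak inequalities between finite signed sums of values, hence closed
  under pointwise limits.\<close>

lemma walsh_nonneg_lim:
  assumes "\<And>n. walsh_nonneg k (f n)" "\<And>s. s < 2 ^ k \<Longrightarrow> (\<lambda>n. f n s) \<longlonglongrightarrow> g s"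
  shows "walsh_nonneg k g"
  using assms
proof (induction k arbitrary: f g)
  case 0
  then show ?case
    by (auto intro: LIMSEQ_le_const)
next
  case (Suc k)
  have lim: "(\<lambda>n. f n (2 * s)) \<longlonglongrightarrow> g (2 * s)" "(\<lambda>n. f n (2 * s + 1)) \<longlonglongrightarrow> g (2 * s + 1)"
    if "s < 2 ^ k" for s
    using that by (auto intro!: Suc.prems(2))
  have "walsh_nonneg k (\<lambda>s. g (2 * s) + g (2 * s + 1))"
    by (rule Suc.IH[of "\<lambda>n s. f n (2 * s) + f n (2 * s + 1)"])
      (use Suc.prems(1) in \<open>auto intro!: tendsto_add lim[simplified]\<close>)
  moreover have "walsh_nonneg k (\<lambda>s. g (2 * s) - g (2 * s + 1))"
    by (rule Suc.IH[of "\<lambda>n s. f n (2 * s) - f n (2 * s + 1)"])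
      (use Suc.prems(1) in \<open>auto intro!: tendsto_diff lim[simplified]\<close>)
  ultimately show ?case
    by simp
qed

text \<open>Geometric series: 1/(c - f) is the sum of f^i / c^(i+1), whose partial sums lie in the
  cone.\<close>

lemma walsh_nonneg_inverse:
  assumes "walsh_nonneg k f" "c > 0" "\<And>s. s < 2 ^ k \<Longrightarrow> \<bar>f s\<bar> < c"
  shows "walsh_nonneg k (\<lambda>s. 1 / (c - f s))"
proof (rule walsh_nonneg_lim)
  show "walsh_nonneg k (\<lambda>s. \<Sum>i<n. (1 / c) * ((1 / c) * f s) ^ i)" for n
    using assms
    by (intro walsh_nonneg_sum walsh_nonneg_cmult walsh_nonneg_power) auto
  fix s :: nat assume s: "s < 2 ^ k"
  with assms have less: "\<bar>f s\<bar> < c" by blast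
  then have "(\<lambda>i. ((1 / c) * f s) ^ i) sums (1 / (1 - (1 / c) * f s))"
    using assms(2) by (intro geometric_sums) (simp add: abs_mult field_simps)
  then have "(\<lambda>i. (1 / c) * ((1 / c) * f s) ^ i) sums ((1 / c) * (1 / (1 - (1 / c) * f s)))"
    by (rule sums_mult)
  moreover have "(1 / c) * (1 / (1 - (1 / c) * f s)) = 1 / (c - f s)"
    using assms(2) less by (simp add: field_simps)
  ultimately show "(\<lambda>n. \<Sum>i<n. (1 / c) * ((1 / c) * f s) ^ i) \<longlonglongrightarrow> 1 / (c - f s)"
    by (simp add: sums_def)
qed

section \<open>Farey rows and the first coordinate\<close>

text \<open>The recursion splits off the last coordinate, the Farey maps act on the first one.\<close>

lemma walsh_nonneg_SucI:
  assumes "walsh_nonneg k (\<lambda>s. f s + f (s + 2 ^ k))" "walsh_nonneg k (\<lambda>s. f s - f (s + 2 ^ k))"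
  shows "walsh_nonneg (Suc k) f"
  using assms
proof (induction k arbitrary: f)
  case (Suc k)
  \<comment> \<open>Shifting \<open>s\<close> by \<open>2 ^ k\<close> shifts \<open>2 * s\<close>
    and \<open>2 * s + 1\<close> by \<open>2 ^ Suc k\<close>, so splitting by the first digit
    commutes with splitting by the last.\<close>
  have "walsh_nonneg (Suc k) (\<lambda>s. f (2 * s) + f (2 * s + 1))"
    by (rule Suc.IH) (use Suc.prems in \<open>simp_all add: algebra_simps\<close>)
  moreover have "walsh_nonneg (Suc k) (\<lambda>s. f (2 * s) - f (2 * s + 1))"
    by (rule Suc.IH) (use Suc.prems in \<open>simp_all add: algebra_simps\<close>)
  ultimately show ?case
    by (subst walsh_nonneg.simps) simp
qed simp

lemma hhat_pos: "hhat k s > 0"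
  by (induction k arbitrary: s) auto

lemma rhat_le_hhat: "rhat k s \<le> hhat k s"
  by (induction k arbitrary: s) (auto intro: add_mono)

text \<open>This is x -> x/(1+x) on numerator-denominator pairs. It acts linearly, and linear maps
  commute with mediants, so the relation passes from row to row.\<close>

lemma farey_first_0:
  "s \<le> 2 ^ k \<Longrightarrow> rhat (Suc k) s = rhat k s \<and> hhat (Suc k) s = hhat k s + rhat k s"
proof (induction k arbitrary: s)
  case 0
  then have "s = 0 \<or> s = 1" by auto
  then show ?case by auto
next
  case (Suc k)
  \<comment> \<open>An odd \<open>s\<close> is strictly below the even bound
    \<open>2 ^ Suc k\<close>, so the right neighbour in the mediant is still in range.\<close>
  have *: "s div 2 \<le> 2 ^ k" "odd s \<Longrightarrow> s div 2 + 1 \<le> 2 ^ k"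
    using Suc.prems by (auto elim!: oddE)
  show ?case
    using Suc.IH[OF *(1)] Suc.IH[OF *(2)]
    by (simp add: rhat.simps(2)[of "Suc k"] hhat.simps(2)[of "Suc k"]
        rhat.simps(2)[of k s] hhat.simps(2)[of k s] del: rhat.simps(2) hhat.simps(2))
qed

text \<open>The same argument for x -> 1/(2-x), that is (r, h) -> (h, 2h - r); the second equation
  is an addition to avoid truncated subtraction.\<close>

lemma farey_first_1:
  "s \<le> 2 ^ k \<Longrightarrow>
    rhat (Suc k) (s + 2 ^ k) = hhat k s \<and> hhat (Suc k) (s + 2 ^ k) + rhat k s = 2 * hhat k s"
proof (induction k arbitrary: s)
  case 0
  then have "s = 0 \<or> s = 1" by auto
  then show ?case by auto
next
  case (Suc k)
  have *: "s div 2 \<le> 2 ^ k" "odd s \<Longrightarrow> s div 2 + 1 \<le> 2 ^ k"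
    using Suc.prems by (auto elim!: oddE)
  have "(s + 2 ^ Suc k) div 2 = s div 2 + 2 ^ k" "even (s + 2 ^ Suc k) = even s"
    by auto
  then show ?case
    using Suc.IH[OF *(1)] Suc.IH[OF *(2)]
    by (auto simp: rhat.simps(2)[of "Suc k"] hhat.simps(2)[of "Suc k"] add.commute[of "2 ^ k"]
        rhat.simps(2)[of k s] hhat.simps(2)[of k s] del: rhat.simps(2) hhat.simps(2))
qed

text \<open>The coordinate y = 1 - 2x turns the Farey symmetry x -> 1 - x into y -> -y, and its sign
  absorbs the minus in \<open>j\<close>.\<close>

definition farey_spin :: "nat \<Rightarrow> nat \<Rightarrow> real" where
  "farey_spin k s = 1 - 2 * (real (rhat k s) / real (hhat k s))"

lemma abs_farey_spin_le_1: "\<bar>farey_spin k s\<bar> \<le> 1"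
proof -
  have "real (rhat k s) / real (hhat k s) \<le> 1"
    using rhat_le_hhat[of k s] hhat_pos[of k s] by simp
  moreover have "real (rhat k s) / real (hhat k s) \<ge> 0"
    by simp
  ultimately show ?thesis
    unfolding farey_spin_def by linarith
qed

lemma farey_spin_even: "farey_spin (Suc k) (2 * s) = farey_spin k s"
  by (simp add: farey_spin_def)

lemma farey_spin_first_0:
  assumes "s \<le> 2 ^ k"
  shows "farey_spin (Suc k) s = (1 + farey_spin k s) / (3 - farey_spin k s)"
proof -
  have pos: "real (hhat k s) > 0" "real (rhat k s) \<ge> 0"
    using hhat_pos by simp_all
  have eq: "real (hhat (Suc k) s) = real (hhat k s) + real (rhat k s)"
    "real (rhat (Suc k) s) = real (rhat k s)"
    using farey_first_0[OF assms] by linarith+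
  have "2 * real (hhat k s) + 2 * real (rhat k s) \<noteq> 0" "real (hhat k s) + real (rhat k s) \<noteq> 0"
    using pos by linarith+
  then show ?thesis
    using pos unfolding farey_spin_def eq by (simp add: divide_simps) (simp add: algebra_simps)
qed

lemma farey_spin_first_1:
  assumes "s \<le> 2 ^ k"
  shows "farey_spin (Suc k) (s + 2 ^ k) = (farey_spin k s - 1) / (3 + farey_spin k s)"
proof -
  have pos: "real (hhat k s) > 0" "real (rhat k s) \<le> real (hhat k s)"
    using hhat_pos rhat_le_hhat by simp_all
  have eq: "real (hhat (Suc k) (s + 2 ^ k)) = 2 * real (hhat k s) - real (rhat k s)"
    "real (rhat (Suc k) (s + 2 ^ k)) = real (hhat k s)"
    using farey_first_1[OF assms] by linarith+
  have "4 * real (hhat k s) - 2 * real (rhat k s) \<noteq> 0" "2 * real (hhat k s) - real (rhat k s) \<noteq> 0"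
    using pos by linarith+
  then show ?thesis
    using pos unfolding farey_spin_def eq by (simp add: divide_simps)
qed

text \<open>The two first-coordinate branches have sum 8y/(9 - y^2) and difference (6 + 2y^2)/(9 -
  y^2). Both are power series in y with nonnegative coefficients, so the cone properties carry the
  induction.\<close>

lemma walsh_nonneg_farey_spin: "walsh_nonneg k (farey_spin k)"
proof (induction k)
  case 0
  show ?case
    by (simp add: farey_spin_def)
next
  case (Suc k)
  let ?y = "farey_spin k"
  have bound: "(?y s)\<^sup>2 \<le> 1" for s
    using abs_farey_spin_le_1[of k s] by (simp add: abs_square_le_1)
  \<comment> \<open>The geometric series is applied to y^2 with \<open>c = 9\<close>; it converges
    because y^2 is at most 1.\<close>
  have inv: "walsh_nonneg k (\<lambda>s. 1 / (9 - (?y s)\<^sup>2))"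
    using bound
    by (intro walsh_nonneg_inverse walsh_nonneg_power Suc) (auto intro: le_less_trans[of _ 1])
  have nz: "3 - ?y s \<noteq> 0" "3 + ?y s \<noteq> 0" "9 - (?y s)\<^sup>2 \<noteq> 0" for s
    using abs_farey_spin_le_1[of k s] bound[of s] by auto
  have fact9: "9 - (?y s)\<^sup>2 = (3 - ?y s) * (3 + ?y s)" for s
    by (simp add: power2_eq_square algebra_simps)
  show ?case
  proof (rule walsh_nonneg_SucI)
    have "walsh_nonneg k (\<lambda>s. 8 * ?y s * (1 / (9 - (?y s)\<^sup>2)))"
      by (intro walsh_nonneg_mult walsh_nonneg_cmult Suc inv) auto
    moreover have "farey_spin (Suc k) s + farey_spin (Suc k) (s + 2 ^ k)
        = 8 * ?y s * (1 / (9 - (?y s)\<^sup>2))" if "s < 2 ^ k" for s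
      using that nz[of s] unfolding fact9
      by (simp add: farey_spin_first_0 farey_spin_first_1 divide_simps)
        (simp add: algebra_simps)
    ultimately show "walsh_nonneg k (\<lambda>s. farey_spin (Suc k) s + farey_spin (Suc k) (s + 2 ^ k))"
      by (rule walsh_nonneg_cong[rotated])
    have "walsh_nonneg k (\<lambda>s. (6 + 2 * (?y s)\<^sup>2) * (1 / (9 - (?y s)\<^sup>2)))"
      by (intro walsh_nonneg_mult walsh_nonneg_add walsh_nonneg_const walsh_nonneg_cmult
          walsh_nonneg_power Suc inv) auto
    moreover have "farey_spin (Suc k) s - farey_spin (Suc k) (s + 2 ^ k)
        = (6 + 2 * (?y s)\<^sup>2) * (1 / (9 - (?y s)\<^sup>2))" if "s < 2 ^ k" for s
      using that nz[of s] unfolding fact9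
      by (simp add: farey_spin_first_0 farey_spin_first_1 divide_simps)
        (simp add: algebra_simps power2_eq_square)
    ultimately show "walsh_nonneg k (\<lambda>s. farey_spin (Suc k) s - farey_spin (Suc k) (s + 2 ^ k))"
      by (rule walsh_nonneg_cong[rotated])
  qed
qed

section \<open>Monotonicity in \<open>k\<close> and passage to the limit\<close>

lemma walsh_farey_spin_Suc_le:
  assumes "t (Suc k) = 0"
  shows "walsh (Suc k) (farey_spin (Suc k)) t \<le> 2 * walsh k (farey_spin k) t"
proof -
  let ?z = "\<lambda>s. farey_spin (Suc k) (2 * s + 1)"
  \<comment> \<open>This is the difference half of the nonnegativity of row \<open>Suc k\<close>,
    whose even entries reproduce row \<open>k\<close>.\<close>
  have "walsh_nonneg k (\<lambda>s. farey_spin k s - ?z s)"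
    using walsh_nonneg_farey_spin[of "Suc k"] by (simp add: farey_spin_even)
  from walsh_nonnegD[OF this] have "walsh k ?z t \<le> walsh k (farey_spin k) t"
    by (simp add: walsh_diff)
  moreover have "walsh (Suc k) (farey_spin (Suc k)) t = walsh k (farey_spin k) t + walsh k ?z t"
    using assms by (simp add: walsh_Suc farey_spin_even walsh_add)
  ultimately show ?thesis
    by simp
qed

theorem theorem1p1:
  fixes \<tau> :: G_infty
  assumes "\<tau> \<noteq> 0"
  shows "j \<tau> \<ge> 0"
proof -
  define t where "t = (\<lambda>i. Poly_Mapping.lookup \<tau> (i - 1))"
  define a where "a k = walsh k (farey_spin k) t / 2 ^ k" for k
  from assms obtain m where m: "Poly_Mapping.lookup \<tau> m \<noteq> 0"
    by (metis lookup_zero poly_mapping_eqI)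
  obtain n where n: "\<And>i. Poly_Mapping.lookup \<tau> i \<noteq> 0 \<Longrightarrow> i < n"
    using finite_lookup[of \<tau>] by (auto simp: finite_nat_set_iff_bounded)
  have F_eq: "(1 / 2 ^ k) * (\<Sum>\<sigma>\<in>G k. F k \<sigma> * (-1) ^ dot k \<sigma> (proj k \<tau>)) = - a k / 2"
    if "k \<ge> n" for k
  proof -
    have "F k \<sigma> = 1 / 2 - (1 / 2) * farey_spin k (index k \<sigma>)" for \<sigma>
      by (simp add: F_def farey_spin_def diff_divide_distrib)
    then have "(\<Sum>\<sigma>\<in>G k. F k \<sigma> * (-1) ^ dot k \<sigma> (proj k \<tau>))
        = walsh k (\<lambda>s. 1 / 2 - (1 / 2) * farey_spin k s) (proj k \<tau>)"
      by (simp add: walsh_def)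
    also have "\<dots> = walsh k (\<lambda>s. 1 / 2 - (1 / 2) * farey_spin k s) t"
      by (rule walsh_cong_upto) (simp add: proj_def t_def)
    also have "\<dots> = walsh k (\<lambda>_. 1 / 2) t - (1 / 2) * walsh k (farey_spin k) t"
      by (simp only: walsh_diff walsh_cmult)
    \<comment> \<open>The mean value 1/2 drops out because the nonzero coordinate
      \<open>Suc m\<close> lies in \<open>{1..k}\<close>: \<open>m < n\<close> and
      \<open>n \<le> k\<close>. This is where \<open>\<tau> \<noteq> 0\<close> enters.\<close>
    also have "walsh k (\<lambda>_. 1 / 2) t = 0"
      using n[OF m] m that by (intro walsh_const_eq_0[of "Suc m"]) (auto simp: t_def)
    finally show ?thesis
      by (simp add: a_def)
  qed
  have a_nonneg: "a k \<ge> 0" for k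
    by (simp add: a_def walsh_nonnegD walsh_nonneg_farey_spin)
  have "a (Suc k) \<le> a k" if "k \<ge> n" for k
  proof -
    \<comment> \<open>By the index shift, \<open>t (Suc k)\<close> is the entry of
      \<open>\<tau>\<close> at \<open>k\<close>, beyond its support.\<close>
    have "t (Suc k) = 0"
      using n[of k] that unfolding t_def by fastforce
    from walsh_farey_spin_Suc_le[of t k, OF this] show ?thesis
      by (simp add: a_def field_simps)
  qed
  then have "decseq (\<lambda>k. a (k + n))"
    by (simp add: decseq_Suc_iff)
  then obtain L where "(\<lambda>k. a (k + n)) \<longlonglongrightarrow> L" "\<And>k. L \<le> a (k + n)"
    using decseq_convergent[of "\<lambda>k. a (k + n)" 0] a_nonneg by blast
  then have L: "a \<longlonglongrightarrow> L" "L \<ge> 0"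
    using a_nonneg by (auto dest: LIMSEQ_offset intro: LIMSEQ_le_const)
  \<comment> \<open>Actual convergence is required, since \<open>lim\<close> is only meaningful
    then; it gives \<open>j \<tau> = L / 2\<close>.\<close>
  have "(\<lambda>k. - a k / 2) \<longlonglongrightarrow> - L / 2"
    by (intro tendsto_intros L) auto
  then have "(\<lambda>k. (1 / 2 ^ k) * (\<Sum>\<sigma>\<in>G k. F k \<sigma> * (-1) ^ dot k \<sigma> (proj k \<tau>))) \<longlonglongrightarrow> - L / 2"
    by (rule Lim_transform_eventually)
      (use F_eq in \<open>auto intro!: eventually_sequentiallyI[of n]\<close>)
  then show ?thesis
    using L(2) by (simp add: j_def limI)
qed

end
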